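(* Let $\Phi=\{\varphi_1,\dots,\varphi_n\}$ be a finite set of $\mathrm{LTL}_f$ properties over $\mathcal{X}\cup\mathcal{Y}$ with multi-property arena $\mathcal{G}^\times=(2^{\mathcal{X}\cup\mathcal{Y}},S^\times,s_0^\times,\delta^\times)$. Define relations $\mathrm{WinM}_i\subseteq S^\times\times 2^\Phi$ by $$\mathrm{WinM}_0:=\mathrm{Max}(\{(s,C)\mid s\models C\}),\qquad \mathrm{WinM}_{i+1}:=\mathrm{Max}\bigl(\mathrm{WinM}_i\cup\mathrm{PreMMC}(\mathrm{WinM}_i)\bigr),$$ and let $\mathrm{WinM}:=\bigcup_{i\ge 0}\mathrm{WinM}_i$ denote the resulting fixed point. Then for all $s\in S^\times$ and $C\subseteq\Phi$, $$(s,C)\in\mathrm{WinM}\iff C\text{ is realizable from }s\ \wedge\ \neg\exists D\supset C.\ D\text{ is realizable from }s.$$ The iteration $\mathrm{WinM}_i$ stabilizes after at most $|S^\times|\cdot 2^{|\Phi|}$ steps.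
   Context: Setting. The set of atomic propositions $\mathsf{AP}=\mathcal{X}\cup\mathcal{Y}$ is partitioned into disjoint sets $\mathcal{X}$ (inputs, controlled by the environment) and $\mathcal{Y}$ (outputs, controlled by the agent). $\mathrm{LTL}_f$ formulas: $\varphi::=\mathrm{true}\mid a\in\mathsf{AP}\mid\neg\varphi\mid\varphi\wedge\varphi\mid \mathsf{X}\varphi\mid\varphi\,\mathsf{U}\,\varphi$. They are interpreted over finite traces $\rho=\rho[0]\cdots\rho[m]$ with $\rho[i]\in 2^{\mathsf{AP}}$ and $|\rho|=m+1$: Boolean cases as usual; $\rho,i\models a$ iff $a\in\rho[i]$; $\rho,i\models\mathsf{X}\varphi$ iff $i+1<|\rho|$ and $\rho,i+1\models\varphi$; $\rho,i\models\varphi_1\mathsf{U}\varphi_2$ iff there is $j$ with $i\le j<|\rho|$, $\rho,j\models\varphi_2$, and $\rho,k\models\varphi_1$ for all $i\le k<j$. $\rho\models\varphi$ iff $\rho,0\models\varphi$. For each $\varphi_i\in\Phi$, let $\mathcal{G}_i=(2^{\mathcal{X}\cup\mathcal{Y}},S_i,q_i^0,\delta_i,F_i)$ be a deterministic finite automaton (finite state set $S_i$, initial state $q_i^0$, transition function $\delta_i:S_i\times 2^{\mathcal{X}\cup\mathcal{Y}}\to S_i$, final states $F_i\subseteq S_i$) recognizing exactly the finite traces satisfying $\varphi_i$. The multi-property arena is the product $\mathcal{G}^\times=(2^{\mathcal{X}\cup\mathcal{Y}},S^\times,s_0^\times,\delta^\times)$ with $S^\times=S_1\times\cdots\times S_n$,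 $s_0^\times=(q_1^0,\dots,q_n^0)$, $\delta^\times((q_1,\dots,q_n),a)=(\delta_1(q_1,a),\dots,\delta_n(q_n,a))$. For $s=(q_1,\dots,q_n)\in S^\times$ and $C\subseteq\Phi$: $s\models C$ iff $q_i\in F_i$ for every $\varphi_i\in C$. A strategy is a function $g:(2^{\mathcal{X}})^*\to 2^{\mathcal{Y}}$. A goal set $C\subseteq\Phi$ is realizable from $s\in S^\times$ if there is a strategy $g$ such that for every input sequence $X_0X_1\cdots\in(2^{\mathcal{X}})^\omega$ the play $s_0:=s$, $s_{t+1}:=\delta^\times(s_t,g(X_0\cdots X_{t-1})\cup X_t)$ reaches some $k$ with $s_k\models C$. For $\mathcal{E}\subseteq S^\times\times 2^\Phi$: $$\mathrm{Max}(\mathcal{E}):=\{(s,C)\in\mathcal{E}\mid \neg\exists (s,D)\in\mathcal{E}\text{ with }C\subset D\},$$ $$\mathrm{PreMMC}(\mathcal{E}):=\{(s,C)\mid \exists Y\in2^{\mathcal{Y}}\ \forall X\in2^{\mathcal{X}}\ \exists D\supseteq C.\ (\delta^\times(s,Y\cup X),D)\in\mathcal{E}\}.$$ Here $\subset$ and $\supset$ denote strict inclusion, and $C,D$ range over subsets of $\Phi$.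
   Formalization: WinM is taken as the value at which the iteration WinM_i stabilizes (its set-theoretic limit), not the literal union of all WinM_i, since the union can keep pairs (s,C) that a later Max removes, which makes the stated equivalence false. *)

theory Defs
  imports Main "HOL-Library.FuncSet"
begin

datatype (atoms: 'p) ltlf =
    LTrue
  | LAtom 'p
  | LNot "'p ltlf"
  | LAnd "'p ltlf" "'p ltlf"
  | LNext "'p ltlf"
  | LUntil "'p ltlf" "'p ltlf"

fun sat_at :: "'p set list \<Rightarrow> nat \<Rightarrow> 'p ltlf \<Rightarrow> bool" where
  "sat_at \<rho> i LTrue \<longleftrightarrow> True"
| "sat_at \<rho> i (LAtom a) \<longleftrightarrow> a \<in> \<rho> ! i"
| "sat_at \<rho> i (LNot \<phi>) \<longleftrightarrow> \<not> sat_at \<rho> i \<phi>"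
| "sat_at \<rho> i (LAnd \<phi> \<psi>) \<longleftrightarrow> sat_at \<rho> i \<phi> \<and> sat_at \<rho> i \<psi>"
| "sat_at \<rho> i (LNext \<phi>) \<longleftrightarrow> i + 1 < length \<rho> \<and> sat_at \<rho> (i + 1) \<phi>"
| "sat_at \<rho> i (LUntil \<phi> \<psi>) \<longleftrightarrow>
     (\<exists>j. i \<le> j \<and> j < length \<rho> \<and> sat_at \<rho> j \<psi> \<and> (\<forall>k. i \<le> k \<and> k < j \<longrightarrow> sat_at \<rho> k \<phi>))"

text \<open>Traces have the form \<open>\<rho>[0]\<cdots>\<rho>[m]\<close>, so they are nonempty.\<close>

definition models :: "'p set \<Rightarrow> 'p ltlf \<Rightarrow> 'p set list set" where
  "models AP \<phi> = {\<rho> \<in> lists (Pow AP). \<rho> \<noteq> [] \<and> sat_at \<rho> 0 \<phi>}"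

record ('p, 's) dfa =
  states :: "'s set"
  init :: 's
  trans_fun :: "'s \<Rightarrow> 'p set \<Rightarrow> 's"
  final :: "'s set"

definition is_dfa :: "'p set \<Rightarrow> ('p, 's) dfa \<Rightarrow> bool" where
  "is_dfa AP A \<longleftrightarrow> finite (states A) \<and> init A \<in> states A \<and> final A \<subseteq> states A \<and>
     (\<forall>q \<in> states A. \<forall>a \<in> Pow AP. trans_fun A q a \<in> states A)"

definition language :: "'p set \<Rightarrow> ('p, 's) dfa \<Rightarrow> 'p set list set" where
  "language AP A = {w \<in> lists (Pow AP). foldl (trans_fun A) (init A) w \<in> final A}"

text \<open>
  A finite set \<open>\<Phi>\<close> of properties serves as its own index set: \<open>G \<phi>\<close> is the automaton of \<open>\<phi>\<close>, and a
  tuple in the product of the state sets is an extensional function on \<open>\<Phi>\<close>.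
\<close>

definition arena_states :: "'p ltlf set \<Rightarrow> ('p ltlf \<Rightarrow> ('p, 's) dfa) \<Rightarrow> ('p ltlf \<Rightarrow> 's) set" where
  "arena_states \<Phi> G = (\<Pi>\<^sub>E \<phi> \<in> \<Phi>. states (G \<phi>))"

definition arena_init :: "'p ltlf set \<Rightarrow> ('p ltlf \<Rightarrow> ('p, 's) dfa) \<Rightarrow> 'p ltlf \<Rightarrow> 's" where
  "arena_init \<Phi> G = (\<lambda>\<phi> \<in> \<Phi>. init (G \<phi>))"

definition arena_step ::
    "'p ltlf set \<Rightarrow> ('p ltlf \<Rightarrow> ('p, 's) dfa) \<Rightarrow> ('p ltlf \<Rightarrow> 's) \<Rightarrow> 'p set \<Rightarrow> 'p ltlf \<Rightarrow> 's" where
  "arena_step \<Phi> G s a = (\<lambda>\<phi> \<in> \<Phi>. trans_fun (G \<phi>) (s \<phi>) a)"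

definition sat_goals :: "('p ltlf \<Rightarrow> ('p, 's) dfa) \<Rightarrow> ('p ltlf \<Rightarrow> 's) \<Rightarrow> 'p ltlf set \<Rightarrow> bool" where
  "sat_goals G s C \<longleftrightarrow> (\<forall>\<phi> \<in> C. s \<phi> \<in> final (G \<phi>))"

text \<open>The output at time \<open>t\<close> depends only on the inputs strictly before \<open>t\<close>.\<close>

primrec play ::
    "'p ltlf set \<Rightarrow> ('p ltlf \<Rightarrow> ('p, 's) dfa) \<Rightarrow> ('p set list \<Rightarrow> 'p set) \<Rightarrow> (nat \<Rightarrow> 'p set) \<Rightarrow>
     ('p ltlf \<Rightarrow> 's) \<Rightarrow> nat \<Rightarrow> 'p ltlf \<Rightarrow> 's" where
  "play \<Phi> G g \<xi> s 0 = s"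
| "play \<Phi> G g \<xi> s (Suc t) = arena_step \<Phi> G (play \<Phi> G g \<xi> s t) (g (map \<xi> [0..<t]) \<union> \<xi> t)"

definition realizable ::
    "'p set \<Rightarrow> 'p set \<Rightarrow> 'p ltlf set \<Rightarrow> ('p ltlf \<Rightarrow> ('p, 's) dfa) \<Rightarrow>
     ('p ltlf \<Rightarrow> 's) \<Rightarrow> 'p ltlf set \<Rightarrow> bool" where
  "realizable X Y \<Phi> G s C \<longleftrightarrow>
     (\<exists>g \<in> lists (Pow X) \<rightarrow> Pow Y. \<forall>\<xi>. (\<forall>t. \<xi> t \<in> Pow X) \<longrightarrow>
        (\<exists>k. sat_goals G (play \<Phi> G g \<xi> s k) C))"

definition Max_pairs :: "('q \<times> 'c set) set \<Rightarrow> ('q \<times> 'c set) set" where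
  "Max_pairs E = {(s, C). (s, C) \<in> E \<and> \<not> (\<exists>D. (s, D) \<in> E \<and> C \<subset> D)}"

definition PreMMC ::
    "'p set \<Rightarrow> 'p set \<Rightarrow> 'p ltlf set \<Rightarrow> ('p ltlf \<Rightarrow> ('p, 's) dfa) \<Rightarrow>
     (('p ltlf \<Rightarrow> 's) \<times> 'p ltlf set) set \<Rightarrow> (('p ltlf \<Rightarrow> 's) \<times> 'p ltlf set) set" where
  "PreMMC X Y \<Phi> G E = {(s, C). s \<in> arena_states \<Phi> G \<and> C \<subseteq> \<Phi> \<and>
     (\<exists>y \<in> Pow Y. \<forall>x \<in> Pow X. \<exists>D. C \<subseteq> D \<and> D \<subseteq> \<Phi> \<and> (arena_step \<Phi> G s (y \<union> x), D) \<in> E)}"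

primrec WinM_iter ::
    "'p set \<Rightarrow> 'p set \<Rightarrow> 'p ltlf set \<Rightarrow> ('p ltlf \<Rightarrow> ('p, 's) dfa) \<Rightarrow>
     nat \<Rightarrow> (('p ltlf \<Rightarrow> 's) \<times> 'p ltlf set) set" where
  "WinM_iter X Y \<Phi> G 0 =
     Max_pairs {(s, C). s \<in> arena_states \<Phi> G \<and> C \<subseteq> \<Phi> \<and> sat_goals G s C}"
| "WinM_iter X Y \<Phi> G (Suc i) =
     Max_pairs (WinM_iter X Y \<Phi> G i \<union> PreMMC X Y \<Phi> G (WinM_iter X Y \<Phi> G i))"

text \<open>
  The iterates are not increasing: \<open>Max_pairs\<close> discards \<open>(s, C)\<close> as soon as a pair \<open>(s, D)\<close> with
  \<open>C \<subset> D\<close> appears, so their plain union retains non-maximal pairs and is in general no fixed point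
  of the iteration. The fixed point reached is the set-theoretic limit: the pairs that
  belong to all iterates from some index on.
\<close>

definition WinM ::
    "'p set \<Rightarrow> 'p set \<Rightarrow> 'p ltlf set \<Rightarrow> ('p ltlf \<Rightarrow> ('p, 's) dfa) \<Rightarrow>
     (('p ltlf \<Rightarrow> 's) \<times> 'p ltlf set) set" where
  "WinM X Y \<Phi> G = (\<Union>N. \<Inter>i \<in> {N..}. WinM_iter X Y \<Phi> G i)"

end

theory Submission imports Defs begin

text \<open>
  Dropping \<open>Max\<close> from the iteration gives the usual attractor computation \<open>Win_iter\<close>, which is
  increasing and downward closed in the goal set, so that for each fixed goal set \<open>C\<close> its slice is
  the attractor of the states satisfying \<open>C\<close>. Since \<open>\<Phi>\<close> is finite, every pair lies below a maximal one,
  and \<open>PreMMC\<close> only looks at pairs up to enlarging the goal set; hence \<open>WinM_iter\<close> is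
  \<open>Max\<close> of \<open>Win_iter\<close> at every stage. The increasing sequence \<open>Win_iter\<close> lives in a set of
  \<open>|S| \<cdot> 2\<^sup>|\<^sup>\<Phi>\<^sup>|\<close> pairs and stabilizes as soon as it repeats. Its limit consists of the realizable pairs:
  attractor ranks yield strategies, and outside of the limit the environment can always avoid it.
\<close>

section \<open>Maximal pairs, and when taking them can be postponed\<close>

lemma Max_pairs_subset: "Max_pairs E \<subseteq> E"
  by (auto simp: Max_pairs_def)

text \<open>The goal sets paired with \<open>s\<close> all lie in the finite set
  \<open>Pow \<Phi>\<close>, so some maximal one contains \<open>C\<close>.\<close>

lemma Max_pairs_above:
  assumes "(s, C) \<in> E" "finite \<Phi>" "\<And>s C. (s, C) \<in> E \<Longrightarrow> C \<subseteq> \<Phi>"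
  obtains D where "C \<subseteq> D" "(s, D) \<in> Max_pairs E"
proof -
  have "{D. (s, D) \<in> E} \<subseteq> Pow \<Phi>"
    using assms(3) by auto
  then have "finite {D. (s, D) \<in> E}"
    using assms(2) by (meson finite_Pow_iff finite_subset)
  then obtain D where "D \<in> {D. (s, D) \<in> E}" "C \<subseteq> D" "\<forall>D' \<in> {D. (s, D) \<in> E}. D \<subseteq> D' \<longrightarrow> D = D'"
    using finite_has_maximal2[of "{D. (s, D) \<in> E}" C] assms(1) by auto
  then show thesis
    by (intro that[of D]) (auto simp: Max_pairs_def)
qed

text \<open>A pair of \<open>E\<close> removed by the inner \<open>Max_pairs\<close> lies strictly
  below a surviving one, so it could not be maximal in the union, and whatever it dominates is still
  dominated.\<close>

lemma Max_pairs_Un: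
  assumes "finite \<Phi>" "\<And>s C. (s, C) \<in> E \<union> F \<Longrightarrow> C \<subseteq> \<Phi>"
  shows "Max_pairs (Max_pairs E \<union> F) = Max_pairs (E \<union> F)"
proof (rule set_eqI, clarify)
  fix s C
  have above: "\<exists>D'. D \<subseteq> D' \<and> (s, D') \<in> Max_pairs E" if "(s, D) \<in> E" for D
    using Max_pairs_above[OF that assms(1)] assms(2) by (metis UnI1)
  show "(s, C) \<in> Max_pairs (Max_pairs E \<union> F) \<longleftrightarrow> (s, C) \<in> Max_pairs (E \<union> F)"
  proof
    assume L: "(s, C) \<in> Max_pairs (Max_pairs E \<union> F)"
    then have "(s, C) \<in> E \<union> F"
      using Max_pairs_subset by blast
    moreover have "\<not> C \<subset> D" if "(s, D) \<in> E \<union> F" for D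
    proof
      assume "C \<subset> D"
      then obtain D' where "C \<subset> D'" "(s, D') \<in> Max_pairs E \<union> F"
        using \<open>(s, D) \<in> E \<union> F\<close> above by (metis UnE UnI1 UnI2 psubset_subset_trans)
      then show False
        using L by (auto simp: Max_pairs_def)
    qed
    ultimately show "(s, C) \<in> Max_pairs (E \<union> F)"
      by (auto simp: Max_pairs_def)
  next
    assume "(s, C) \<in> Max_pairs (E \<union> F)"
    then show "(s, C) \<in> Max_pairs (Max_pairs E \<union> F)"
      by (auto simp: Max_pairs_def)
  qed
qed

text \<open>\<open>PreMMC\<close> asks only for some \<open>D\<close> above \<open>C\<close> at each
  successor, and any such witness can be enlarged to a maximal one.\<close>

lemma PreMMC_Max_pairs:
  assumes "finite \<Phi>" "\<And>s C. (s, C) \<in> E \<Longrightarrow> C \<subseteq> \<Phi>"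
  shows "PreMMC X Y \<Phi> G (Max_pairs E) = PreMMC X Y \<Phi> G E"
proof -
  have "(\<exists>D. C \<subseteq> D \<and> D \<subseteq> \<Phi> \<and> (s, D) \<in> Max_pairs E) \<longleftrightarrow> (\<exists>D. C \<subseteq> D \<and> D \<subseteq> \<Phi> \<and> (s, D) \<in> E)"
    for s C
  proof
    assume "\<exists>D. C \<subseteq> D \<and> D \<subseteq> \<Phi> \<and> (s, D) \<in> E"
    then obtain D where D: "C \<subseteq> D" "(s, D) \<in> E"
      by blast
    obtain D' where "D \<subseteq> D'" "(s, D') \<in> Max_pairs E"
      using Max_pairs_above[OF D(2) assms] .
    moreover from this have "D' \<subseteq> \<Phi>"
      using assms(2) Max_pairs_subset by blast
    ultimately show "\<exists>D. C \<subseteq> D \<and> D \<subseteq> \<Phi> \<and> (s, D) \<in> Max_pairs E"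
      using D(1) by blast
  qed (use Max_pairs_subset in blast)
  then show ?thesis
    by (simp add: PreMMC_def)
qed

section \<open>The attractor iteration and its relation to \<open>WinM_iter\<close>\<close>

primrec Win_iter ::
    "'p set \<Rightarrow> 'p set \<Rightarrow> 'p ltlf set \<Rightarrow> ('p ltlf \<Rightarrow> ('p, 's) dfa) \<Rightarrow>
     nat \<Rightarrow> (('p ltlf \<Rightarrow> 's) \<times> 'p ltlf set) set" where
  "Win_iter X Y \<Phi> G 0 = {(s, C). s \<in> arena_states \<Phi> G \<and> C \<subseteq> \<Phi> \<and> sat_goals G s C}"
| "Win_iter X Y \<Phi> G (Suc i) = Win_iter X Y \<Phi> G i \<union> PreMMC X Y \<Phi> G (Win_iter X Y \<Phi> G i)"

lemma Win_iter_subset: "Win_iter X Y \<Phi> G i \<subseteq> arena_states \<Phi> G \<times> Pow \<Phi>"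
  by (induction i) (auto simp: PreMMC_def)

lemma Win_iter_mono: "i \<le> j \<Longrightarrow> Win_iter X Y \<Phi> G i \<subseteq> Win_iter X Y \<Phi> G j"
  by (rule lift_Suc_mono_le) auto

text \<open>\<open>PreMMC\<close> lets the goal set grow from a state to its successors; downward
  closure brings it back to the original \<open>C\<close>, so that one goal set can be followed
  along a whole play.\<close>

lemma Win_iter_antimono:
  "(s, D) \<in> Win_iter X Y \<Phi> G i \<Longrightarrow> C \<subseteq> D \<Longrightarrow> (s, C) \<in> Win_iter X Y \<Phi> G i"
proof (induction i)
  case 0
  then show ?case
    by (auto simp: sat_goals_def)
next
  case (Suc i)
  from Suc.prems(1) consider "(s, D) \<in> Win_iter X Y \<Phi> G i" | "(s, D) \<in> PreMMC X Y \<Phi> G (Win_iter X Y \<Phi> G i)"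
    by auto
  then show ?case
  proof cases
    case 2
    with Suc.prems(2) have "(s, C) \<in> PreMMC X Y \<Phi> G (Win_iter X Y \<Phi> G i)"
      unfolding PreMMC_def mem_Collect_eq prod.case by (meson order_trans)
    then show ?thesis
      by simp
  qed (use Suc in simp)
qed

lemma WinM_iter_eq_Max_pairs:
  assumes "finite \<Phi>"
  shows "WinM_iter X Y \<Phi> G i = Max_pairs (Win_iter X Y \<Phi> G i)"
proof (induction i)
  case (Suc i)
  have sub: "C \<subseteq> \<Phi>" if "(s, C) \<in> Win_iter X Y \<Phi> G i \<union> PreMMC X Y \<Phi> G (Win_iter X Y \<Phi> G i)" for s C
    using that Win_iter_subset[of X Y \<Phi> G "Suc i"] by auto
  have "PreMMC X Y \<Phi> G (Max_pairs (Win_iter X Y \<Phi> G i)) = PreMMC X Y \<Phi> G (Win_iter X Y \<Phi> G i)"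
    using assms sub by (intro PreMMC_Max_pairs) auto
  then show ?case
    using Max_pairs_Un[OF assms sub] by (simp add: Suc)
qed simp

section \<open>Stabilization of increasing iterations in a finite set\<close>

lemma finite_increasing_stable:
  fixes W :: "nat \<Rightarrow> 'a set"
  assumes "finite A" "\<And>i. W i \<subseteq> A" "\<And>i. W i \<subseteq> W (Suc i)"
    and stable: "\<And>i. W (Suc i) = W i \<Longrightarrow> W (Suc (Suc i)) = W (Suc i)"
    and "card A \<le> i"
  shows "W i = W (card A)"
proof -
  have "mono W"
    using assms(3) by (simp add: mono_iff_le_Suc)
  moreover have "finite (range W)"
    using assms(1,2) by (meson finite_Pow_iff finite_subset image_subsetI PowI)
  moreover have "\<forall>i. W i = W (Suc i) \<longrightarrow> W (Suc i) = W (Suc (Suc i))"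
    using stable by metis
  \<comment> \<open>Until the first repetition each step adds an element of \<open>A\<close>, so at
    most \<open>card A\<close> steps are strict; after a repetition nothing changes.\<close>
  ultimately have "W (card A) = (\<Union>i. W i)"
    using assms(1,2) by (intro finite_mono_strict_prefix_implies_finite_fixpoint
        finite_mono_remains_stable_implies_strict_prefix)
  then show ?thesis
    using assms(3,5) lift_Suc_mono_le[of W "card A" i] by blast
qed

lemma Win_iter_stable:
  assumes "finite \<Phi>" "finite (arena_states \<Phi> G)" "card (arena_states \<Phi> G) * 2 ^ card \<Phi> \<le> i"
  shows "Win_iter X Y \<Phi> G i = Win_iter X Y \<Phi> G (card (arena_states \<Phi> G) * 2 ^ card \<Phi>)"
proof -
  have card: "card (arena_states \<Phi> G \<times> Pow \<Phi>) = card (arena_states \<Phi> G) * 2 ^ card \<Phi>"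
    by (simp add: card_cartesian_product card_Pow assms(1))
  have "Win_iter X Y \<Phi> G i = Win_iter X Y \<Phi> G (card (arena_states \<Phi> G \<times> Pow \<Phi>))"
  proof (rule finite_increasing_stable)
    show "Win_iter X Y \<Phi> G (Suc (Suc i)) = Win_iter X Y \<Phi> G (Suc i)"
      if "Win_iter X Y \<Phi> G (Suc i) = Win_iter X Y \<Phi> G i" for i
      using that by (metis Win_iter.simps(2))
  next
    show "Win_iter X Y \<Phi> G i \<subseteq> arena_states \<Phi> G \<times> Pow \<Phi>" for i
      by (rule Win_iter_subset)
  next
    show "card (arena_states \<Phi> G \<times> Pow \<Phi>) \<le> i"
      using assms(3) card by simp
  qed (use assms(1,2) in auto)
  then show ?thesis
    unfolding card .
qed

section \<open>Realizability as membership in the attractor\<close>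

lemma play_Suc_shift:
  "play \<Phi> G g \<xi> s (Suc t) =
   play \<Phi> G (\<lambda>xs. g (\<xi> 0 # xs)) (\<lambda>t. \<xi> (Suc t)) (arena_step \<Phi> G s (g [] \<union> \<xi> 0)) t"
proof (induction t)
  case (Suc t)
  have "map \<xi> [0..<Suc t] = \<xi> 0 # map (\<lambda>t. \<xi> (Suc t)) [0..<t]"
    by (simp add: map_upt_Suc del: upt_Suc)
  then show ?case
    unfolding play.simps(2)[of _ _ _ _ _ "Suc t"] Suc by simp
qed simp

lemma arena_step_closed:
  assumes "\<And>\<phi>. \<phi> \<in> \<Phi> \<Longrightarrow> is_dfa AP (G \<phi>)" "s \<in> arena_states \<Phi> G" "a \<subseteq> AP"
  shows "arena_step \<Phi> G s a \<in> arena_states \<Phi> G"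
  using assms by (auto simp: arena_states_def arena_step_def is_dfa_def PiE_iff)

text \<open>Induction on the attractor rank: play the output given by \<open>PreMMC\<close>, then
  continue with a strategy from the successor, which has smaller rank.\<close>

lemma Win_iter_imp_realizable:
  "(s, C) \<in> Win_iter X Y \<Phi> G i \<Longrightarrow> realizable X Y \<Phi> G s C"
proof (induction i arbitrary: s)
  case 0
  then have "sat_goals G (play \<Phi> G g \<xi> s 0) C" for g \<xi>
    by simp
  \<comment> \<open>The goal already holds at time 0, so any strategy serves.\<close>
  moreover have "(\<lambda>_. {}) \<in> lists (Pow X) \<rightarrow> Pow Y"
    by simp
  ultimately show ?case
    unfolding realizable_def by blast
next
  case (Suc i)
  show ?case
  proof (cases "(s, C) \<in> Win_iter X Y \<Phi> G i")
    case False
    with Suc.prems have "(s, C) \<in> PreMMC X Y \<Phi> G (Win_iter X Y \<Phi> G i)"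
      by simp
    then obtain y where y: "y \<in> Pow Y"
      and "\<forall>x \<in> Pow X. \<exists>D. C \<subseteq> D \<and> D \<subseteq> \<Phi> \<and> (arena_step \<Phi> G s (y \<union> x), D) \<in> Win_iter X Y \<Phi> G i"
      unfolding PreMMC_def by blast
    then have "\<forall>x \<in> Pow X. realizable X Y \<Phi> G (arena_step \<Phi> G s (y \<union> x)) C"
      using Suc.IH Win_iter_antimono by blast
    then obtain h where h: "\<And>x. x \<in> Pow X \<Longrightarrow> h x \<in> lists (Pow X) \<rightarrow> Pow Y"
      and win: "\<And>x \<xi>. x \<in> Pow X \<Longrightarrow> \<forall>t. \<xi> t \<in> Pow X \<Longrightarrow>
        \<exists>k. sat_goals G (play \<Phi> G (h x) \<xi> (arena_step \<Phi> G s (y \<union> x)) k) C"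
      unfolding realizable_def by metis
    \<comment> \<open>The output \<open>y\<close> is fixed before any input is seen; the first input
      \<open>x\<close> then selects the strategy \<open>h x\<close> for the remaining
      history.\<close>
    define g where "g xs = (case xs of [] \<Rightarrow> y | x # xs \<Rightarrow> h x xs)" for xs
    have "g \<in> lists (Pow X) \<rightarrow> Pow Y"
    proof
      fix xs assume "xs \<in> lists (Pow X)"
      then show "g xs \<in> Pow Y"
        by cases (use y in \<open>simp add: g_def\<close>, use h in \<open>simp add: g_def Pi_iff\<close>)
    qed
    moreover have "\<exists>k. sat_goals G (play \<Phi> G g \<xi> s k) C" if inputs: "\<forall>t. \<xi> t \<in> Pow X" for \<xi>
    proof -
      obtain k where "sat_goals G (play \<Phi> G (h (\<xi> 0)) (\<lambda>t. \<xi> (Suc t)) (arena_step \<Phi> G s (y \<union> \<xi> 0)) k) C"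
        using win[of "\<xi> 0" "\<lambda>t. \<xi> (Suc t)"] inputs by blast
      \<comment> \<open>\<open>play\<close> recurses on the last round, whereas the induction needs
        the first one split off; hence the shift and the index \<open>Suc k\<close>.\<close>
      then have "sat_goals G (play \<Phi> G g \<xi> s (Suc k)) C"
        unfolding play_Suc_shift by (simp add: g_def)
      then show ?thesis ..
    qed
    ultimately show ?thesis
      unfolding realizable_def by blast
  qed (use Suc.IH in blast)
qed

text \<open>Outside the fixed point every output admits an input that keeps the play outside.
  Iterating this choice against a supposedly winning \<open>g\<close> yields an input sequence on
  which \<open>C\<close> is never satisfied.\<close>

lemma realizable_imp_Win_iter:
  assumes dfa: "\<And>\<phi>. \<phi> \<in> \<Phi> \<Longrightarrow> is_dfa (X \<union> Y) (G \<phi>)"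
    and fixpoint: "Win_iter X Y \<Phi> G (Suc N) = Win_iter X Y \<Phi> G N"
    and s: "s \<in> arena_states \<Phi> G" and C: "C \<subseteq> \<Phi>"
    and real: "realizable X Y \<Phi> G s C"
  shows "(s, C) \<in> Win_iter X Y \<Phi> G N"
proof (rule ccontr)
  let ?W = "Win_iter X Y \<Phi> G N"
  assume notin: "(s, C) \<notin> ?W"
  obtain g where g: "g \<in> lists (Pow X) \<rightarrow> Pow Y"
    and win: "\<And>\<xi>. \<forall>t. \<xi> t \<in> Pow X \<Longrightarrow> \<exists>k. sat_goals G (play \<Phi> G g \<xi> s k) C"
    using real unfolding realizable_def by blast
  have escape: "\<exists>x \<in> Pow X. (arena_step \<Phi> G q (y \<union> x), C) \<notin> ?W"
    if "q \<in> arena_states \<Phi> G" "(q, C) \<notin> ?W" "y \<in> Pow Y" for q y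
  proof (rule ccontr)
    assume "\<not> ?thesis"
    \<comment> \<open>If all inputs led into \<open>?W\<close>, then \<open>D = C\<close> would
      witness \<open>PreMMC\<close>.\<close>
    then have "(q, C) \<in> PreMMC X Y \<Phi> G ?W"
      using that C by (auto simp: PreMMC_def)
    then show False
      using that(2) fixpoint by auto
  qed
  define next_input where "next_input q y =
      (SOME x. x \<in> Pow X \<and> (arena_step \<Phi> G q (y \<union> x), C) \<notin> ?W)" for q y
  have next_input: "next_input q y \<in> Pow X" "(arena_step \<Phi> G q (y \<union> next_input q y), C) \<notin> ?W"
    if "q \<in> arena_states \<Phi> G" "(q, C) \<notin> ?W" "y \<in> Pow Y" for q y
    using someI_ex[OF escape[OF that, unfolded Bex_def]] unfolding next_input_def by blast+
  \<comment> \<open>The next input depends on the current state and on the reply of \<open>g\<close>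
    to the history, so history and state are built together; \<open>\<xi>\<close> is then read off,
    and the state turns out to be the play of \<open>g\<close> on \<open>\<xi>\<close>.\<close>
  define run where "run = rec_nat ([], s) (\<lambda>_ (h, q).
      let x = next_input q (g h) in (h @ [x], arena_step \<Phi> G q (g h \<union> x)))"
  define \<xi> where "\<xi> t = next_input (snd (run t)) (g (fst (run t)))" for t
  have run: "run 0 = ([], s)"
    "run (Suc t) = (fst (run t) @ [\<xi> t], arena_step \<Phi> G (snd (run t)) (g (fst (run t)) \<union> \<xi> t))" for t
    by (simp_all add: run_def \<xi>_def Let_def split_beta)
  have fst_run: "fst (run t) = map \<xi> [0..<t]" for t
    by (induction t) (simp_all add: run)
  have snd_run: "snd (run t) = play \<Phi> G g \<xi> s t" for t
    by (induction t) (simp_all add: run fst_run)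
  have avoid: "fst (run t) \<in> lists (Pow X) \<and> snd (run t) \<in> arena_states \<Phi> G \<and> (snd (run t), C) \<notin> ?W" for t
  proof (induction t)
    case 0
    then show ?case
      using s notin by (simp add: run)
  next
    case (Suc t)
    then have out: "g (fst (run t)) \<in> Pow Y"
      using g by auto
    note x = next_input[OF _ _ this, of "snd (run t)", folded \<xi>_def]
    have "arena_step \<Phi> G (snd (run t)) (g (fst (run t)) \<union> \<xi> t) \<in> arena_states \<Phi> G"
      using Suc x(1) out dfa by (intro arena_step_closed[where AP = "X \<union> Y"]) auto
    then show ?case
      using Suc x by (simp add: run)
  qed
  have "\<xi> t \<in> Pow X" for t
    using avoid[of "Suc t"] by (simp add: run)
  then obtain k where "sat_goals G (snd (run k)) C"
    using win snd_run by metis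
  then have "(snd (run k), C) \<in> Win_iter X Y \<Phi> G 0"
    using avoid C by simp
  then show False
    using avoid[of k] Win_iter_mono[of 0 N] by blast
qed

lemma Win_iter_iff_realizable:
  assumes "\<And>\<phi>. \<phi> \<in> \<Phi> \<Longrightarrow> is_dfa (X \<union> Y) (G \<phi>)"
    and "Win_iter X Y \<Phi> G (Suc N) = Win_iter X Y \<Phi> G N"
    and "s \<in> arena_states \<Phi> G" "C \<subseteq> \<Phi>"
  shows "(s, C) \<in> Win_iter X Y \<Phi> G N \<longleftrightarrow> realizable X Y \<Phi> G s C"
  using assms Win_iter_imp_realizable realizable_imp_Win_iter by metis

theorem theorem3:
  fixes X Y :: "'p set"
    and \<Phi> :: "'p ltlf set"
    and G :: "'p ltlf \<Rightarrow> ('p, 's) dfa"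
  assumes "X \<inter> Y = {}"
    and "finite \<Phi>"
    and "\<And>\<phi>. \<phi> \<in> \<Phi> \<Longrightarrow> atoms \<phi> \<subseteq> X \<union> Y"
    and "\<And>\<phi>. \<phi> \<in> \<Phi> \<Longrightarrow> is_dfa (X \<union> Y) (G \<phi>)"
    and "\<And>\<phi>. \<phi> \<in> \<Phi> \<Longrightarrow> language (X \<union> Y) (G \<phi>) = models (X \<union> Y) \<phi>"
  shows "(\<forall>s \<in> arena_states \<Phi> G. \<forall>C. C \<subseteq> \<Phi> \<longrightarrow>
            ((s, C) \<in> WinM X Y \<Phi> G \<longleftrightarrow>
               realizable X Y \<Phi> G s C \<and> \<not> (\<exists>D. D \<subseteq> \<Phi> \<and> C \<subset> D \<and> realizable X Y \<Phi> G s D)))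
       \<and> (\<forall>i \<ge> card (arena_states \<Phi> G) * 2 ^ card \<Phi>. WinM_iter X Y \<Phi> G i = WinM X Y \<Phi> G)"
proof -
  let ?N = "card (arena_states \<Phi> G) * 2 ^ card \<Phi>"
  let ?W = "Win_iter X Y \<Phi> G ?N"
  have "finite (arena_states \<Phi> G)"
    using assms(2,4) unfolding arena_states_def by (intro finite_PiE) (auto simp: is_dfa_def)
  then have stable: "Win_iter X Y \<Phi> G i = ?W" if "?N \<le> i" for i
    using Win_iter_stable assms(2) that by blast
  then have iter: "WinM_iter X Y \<Phi> G i = Max_pairs ?W" if "?N \<le> i" for i
    using that WinM_iter_eq_Max_pairs[OF assms(2)] by metis
  have WinM: "WinM X Y \<Phi> G = Max_pairs ?W"
  proof
    show "WinM X Y \<Phi> G \<subseteq> Max_pairs ?W"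
    proof
      fix p assume "p \<in> WinM X Y \<Phi> G"
      then obtain M where "\<And>i. M \<le> i \<Longrightarrow> p \<in> WinM_iter X Y \<Phi> G i"
        unfolding WinM_def by auto
      \<comment> \<open>An index beyond both thresholds: \<open>p\<close> belongs to this iterate,
        and the iterate has already stabilized.\<close>
      then have "p \<in> WinM_iter X Y \<Phi> G (max M ?N)"
        by simp
      then show "p \<in> Max_pairs ?W"
        by (simp add: iter)
    qed
    show "Max_pairs ?W \<subseteq> WinM X Y \<Phi> G"
    proof
      fix p assume "p \<in> Max_pairs ?W"
      then have "p \<in> (\<Inter>i \<in> {?N..}. WinM_iter X Y \<Phi> G i)"
        by (simp add: iter)
      then show "p \<in> WinM X Y \<Phi> G"
        unfolding WinM_def by (rule UN_I[OF UNIV_I])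
    qed
  qed
  have "Win_iter X Y \<Phi> G (Suc ?N) = ?W"
    by (rule stable) simp
  then have win: "(s, C) \<in> ?W \<longleftrightarrow> realizable X Y \<Phi> G s C"
    if "s \<in> arena_states \<Phi> G" "C \<subseteq> \<Phi>" for s C
    using that assms(4) by (intro Win_iter_iff_realizable)
  have "(s, C) \<in> WinM X Y \<Phi> G \<longleftrightarrow>
      realizable X Y \<Phi> G s C \<and> \<not> (\<exists>D. D \<subseteq> \<Phi> \<and> C \<subset> D \<and> realizable X Y \<Phi> G s D)"
    if "s \<in> arena_states \<Phi> G" "C \<subseteq> \<Phi>" for s C
  proof -
    \<comment> \<open>With the slice of \<open>?W\<close> at \<open>s\<close> identified for all
      \<open>D\<close>, maximality in \<open>?W\<close> becomes maximality among realizable subsets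
      of \<open>\<Phi>\<close>.\<close>
    have "(s, D) \<in> ?W \<longleftrightarrow> D \<subseteq> \<Phi> \<and> realizable X Y \<Phi> G s D" for D
      using win[OF that(1), of D] Win_iter_subset[of X Y \<Phi> G ?N] by blast
    then show ?thesis
      using that(2) by (auto simp: WinM Max_pairs_def)
  qed
  then show ?thesis
    by (simp add: iter WinM)
qed

end
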